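(* Let $n,m,r,s$ be positive integers with $m>r$ and $n>r$, and let $\lambda=(n^m,r^s)$. If $n=r+1$, or $n=r+2$, or ($n>r+2$ and $n-r$ is even), then $\mathrm{SG}(\lambda)=0$ if $r+m$ is even and $\mathrm{SG}(\lambda)=1$ if $r+m$ is odd. If $n>r+2$ and $n-r$ is odd, then $\mathrm{SG}(\lambda)=0$ if $m-r$ is odd and $m-r\ge 3$; $\mathrm{SG}(\lambda)=1$ if $m-r=1$ or if $m-r$ is even and $m-r\ge 4$; and $\mathrm{SG}(\lambda)=2$ if $m-r=2$.
   Context: A partition is a finite weakly decreasing sequence of positive integers; $(a^k)$ denotes $k$ parts equal to $a$, so $(n^m,r^s)$ has $m$ parts equal to $n$ followed by $s$ parts equal to $r$. LCTR is the impartial game on partitions where from a nonempty $\lambda=(\lambda_1,\dots,\lambda_k)$ one may move to $T(\lambda)=(\lambda_2,\dots,\lambda_k)$ or to $L(\lambda)=(\lambda_1-1,\dots,\lambda_k-1)$ (nonpositive entries omitted); the empty partition has no moves. $\mathrm{SG}(())=0$ and $\mathrm{SG}(\lambda)=\mathrm{mex}\{\mathrm{SG}(L(\lambda)),\mathrm{SG}(T(\lambda))\}$ otherwise, $\mathrm{mex}(B)$ being the least nonnegative integer not in $B$. *)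

theory Defs
  imports Main
begin

text \<open>Partitions are lists of natural numbers. The moves and the Sprague-Grundy function are
  defined on all lists; only their values on partitions are meaningful, and
  partitions are closed under both moves.\<close>

definition is_partition :: "nat list \<Rightarrow> bool" where
  "is_partition l \<longleftrightarrow> sorted_wrt (\<ge>) l \<and> (\<forall>x \<in> set l. 0 < x)"

definition move_T :: "nat list \<Rightarrow> nat list" where
  "move_T l = tl l"

definition move_L :: "nat list \<Rightarrow> nat list" where
  "move_L l = filter (\<lambda>x. 0 < x) (map (\<lambda>x. x - 1) l)"

definition mex :: "nat set \<Rightarrow> nat" where
  "mex B = (LEAST k. k \<notin> B)"

lemma move_T_decreases:
  "l \<noteq> [] \<Longrightarrow> sum_list (move_T l) + length (move_T l) < sum_list l + length l"
  by (cases l) (auto simp: move_T_def)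

lemma move_L_le: "sum_list (move_L l) + length (move_L l) \<le> sum_list l + length l"
  by (induction l) (auto simp: move_L_def)

lemma move_L_decreases:
  "l \<noteq> [] \<Longrightarrow> sum_list (move_L l) + length (move_L l) < sum_list l + length l"
proof (cases l)
  case (Cons x xs)
  then show ?thesis
    using move_L_le[of xs] by (auto simp: move_L_def)
qed simp

function SG :: "nat list \<Rightarrow> nat" where
  "SG l = (if l = [] then 0 else mex {SG (move_L l), SG (move_T l)})"
  by pat_completeness auto
termination
  by (relation "measure (\<lambda>l. sum_list l + length l)")
    (auto simp: move_T_decreases move_L_decreases)

declare SG.simps [simp del]

lemma is_partition_move_T: "is_partition l \<Longrightarrow> is_partition (move_T l)"
  by (cases l) (auto simp: is_partition_def move_T_def)

lemma is_partition_move_L: "is_partition l \<Longrightarrow> is_partition (move_L l)"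
  by (induction l) (auto simp: is_partition_def move_L_def)

definition two_block :: "nat \<Rightarrow> nat \<Rightarrow> nat \<Rightarrow> nat \<Rightarrow> nat list" where
  "two_block n m r s = replicate m n @ replicate s r"

lemma is_partition_two_block:
  "0 < r \<Longrightarrow> r < n \<Longrightarrow> is_partition (two_block n m r s)"
proof -
  have *: "sorted_wrt (\<ge>) (replicate k (x::nat))" for k x
    by (induction k) auto
  show "0 < r \<Longrightarrow> r < n \<Longrightarrow> is_partition (two_block n m r s)"
    by (auto simp: is_partition_def two_block_def sorted_wrt_append *)
qed

end

theory Submission
  imports Defs
begin

text \<open>Write \<open>d = n - r\<close> and \<open>k = m - r\<close>. Both moves preserve \<open>d\<close>; \<open>L\<close> lowers \<open>r\<close> and raises \<open>k\<close>
  by one, while \<open>T\<close> lowers \<open>k\<close> by one. For fixed \<open>d\<close>, induction on \<open>r\<close> and then on \<open>k\<close> determines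
  the values for \<open>k \<ge> 1\<close>, starting from the rectangles reached at \<open>r = 0\<close>. The values for \<open>k < 0\<close>
  depend on \<open>s\<close>, but a position never shares its value with an option of it, and this
  restricts the values at the boundary of \<open>k \<ge> 1\<close> enough.\<close>

lemma mex_pair:
  "mex {x, y} = (if x \<noteq> 0 \<and> y \<noteq> 0 then 0 else if x \<noteq> 1 \<and> y \<noteq> 1 then 1 else 2)"
  unfolding mex_def
proof (rule Least_equality)
  show "(if x \<noteq> 0 \<and> y \<noteq> 0 then 0 else if x \<noteq> 1 \<and> y \<noteq> 1 then 1 else 2) \<notin> {x, y}"
    by auto
  show "(if x \<noteq> 0 \<and> y \<noteq> 0 then 0 else if x \<noteq> 1 \<and> y \<noteq> 1 then 1 else 2) \<le> z"
    if "z \<notin> {x, y}" for z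
    using that by (cases "z = 0"; cases "z = 1") auto
qed

lemma mex_singleton: "mex {x} = (if x = 0 then 1 else 0)"
  using mex_pair[of x x] by simp

lemma SG_Nil: "SG [] = 0"
  by (simp add: SG.simps)

text \<open>The case \<open>a = 0\<close> stands apart because L empties a column of ones, while
  \<open>replicate (Suc b) 0\<close> is a nonempty list and no partition.\<close>

lemma SG_rectangle_Suc:
  "SG (replicate (Suc b) (Suc a)) =
    mex {if a = 0 then 0 else SG (replicate (Suc b) a), SG (replicate b (Suc a))}"
  using SG.simps[of "replicate (Suc b) (Suc a)"] by (simp add: move_L_def move_T_def SG_Nil)

lemma SG_rectangle:
  assumes "0 < a" and "0 < b"
  shows "SG (replicate b a) =
    (if a = 1 then if odd b then 1 else 2
     else if a = 2 then if odd b then 2 else 0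
     else if odd a then if b = 1 then 1 else if b = 2 then 2 else if odd b then 0 else 1
     else if b = 1 then 2 else if odd b then 1 else 0)"
  using assms
proof (induction a arbitrary: b)
  case (Suc a)
  note IHa = Suc.IH
  show ?case
    using \<open>0 < b\<close>
  proof (induction b)
    case (Suc b)
    \<comment> \<open>From width 3 and height 3 on, only parities matter, so this split settles
      which table entries the two neighbours have.\<close>
    have "b = 0 \<or> b = 1 \<or> b = 2 \<or> 3 \<le> b" and "a = 0 \<or> a = 1 \<or> a = 2 \<or> 3 \<le> a"
      by auto
    then show ?case
      using IHa[of "Suc b"] Suc.IH
      unfolding SG_rectangle_Suc mex_pair
      by (elim disjE) (simp_all add: SG_Nil del: replicate_Suc)
  qed simp
qed simp

lemma SG_two_block_Suc:
  assumes "0 < n" and "0 < r"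
  shows "SG (two_block (Suc n) (Suc m) (Suc r) s) =
    mex {SG (two_block n (Suc m) r s), SG (two_block (Suc n) m (Suc r) s)}"
  using assms SG.simps[of "two_block (Suc n) (Suc m) (Suc r) s"]
  by (simp add: two_block_def move_L_def move_T_def)

text \<open>When the lower block consists of ones, L deletes it, so this option is a rectangle and
  no longer depends on \<open>s\<close>.\<close>

lemma SG_two_block_one:
  assumes "0 < n"
  shows "SG (two_block (Suc n) (Suc m) 1 s) =
    mex {SG (replicate (Suc m) n), SG (two_block (Suc n) m 1 s)}"
  using assms SG.simps[of "two_block (Suc n) (Suc m) 1 s"]
  by (simp add: two_block_def move_L_def move_T_def)

lemma SG_two_block_zero_one:
  "0 < s \<Longrightarrow> SG (two_block n 0 1 s) = (if odd s then 1 else 2)"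
  by (simp add: two_block_def SG_rectangle)

lemma SG_two_block_even_or_one:
  assumes "0 < r" and "0 < s" and "0 < d" and "d = 1 \<or> even d"
  shows "SG (two_block (r + d) (r + Suc k) r s) = (if even k then 1 else 0)"
proof -
  \<comment> \<open>At \<open>m = r\<close> excluding 1 is enough: for the next row count the L
    option is not 1 either and one option is 0, which forces the value 1.\<close>
  have "SG (two_block (r + d) r r s) \<noteq> 1 \<and>
    (\<forall>k. SG (two_block (r + d) (r + Suc k) r s) = (if even k then 1 else 0))"
    using \<open>0 < r\<close>
  proof (induction r rule: nat_induct_non_zero)
    case 1
    \<comment> \<open>The rectangle reached by L only has to avoid the claimed value; the T option
      then decides the mex.\<close>
    have rect: "SG (replicate (Suc (Suc k)) d) \<noteq> (if even k then 1 else 0)" for k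
      using assms SG_rectangle[of d "Suc (Suc k)"] by (auto simp del: replicate_Suc)
    have base: "SG (two_block (1 + d) 1 1 s) = 0"
      using assms SG_two_block_one[of d 0 s] SG_rectangle[of d 1]
      by (auto simp: mex_pair mex_singleton SG_two_block_zero_one[unfolded One_nat_def])
    have "SG (two_block (1 + d) (1 + Suc k) 1 s) = (if even k then 1 else 0)" for k
    proof (induction k)
      case 0
      then show ?case
        using assms base rect[of 0] SG_two_block_one[of d 1 s]
        by (simp add: mex_pair mex_singleton del: replicate_Suc)
    next
      case (Suc k)
      then show ?case
        using assms rect[of "Suc k"] SG_two_block_one[of d "Suc (Suc k)" s]
        by (simp add: mex_pair mex_singleton del: replicate_Suc split: if_splits)
    qed
    with base show ?case by simp
  next
    case (Suc r)
    have left: "SG (two_block (r + d) (r + Suc k) r s) = (if even k then 1 else 0)" for k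
      using Suc.IH by blast
    \<comment> \<open>The L option has value 1, whatever T gives.\<close>
    have base: "SG (two_block (Suc r + d) (Suc r) (Suc r) s) \<noteq> 1"
      using \<open>0 < r\<close> left[of 0] SG_two_block_Suc[of "r + d" r r s] by (auto simp: mex_pair mex_singleton)
    have "SG (two_block (Suc r + d) (Suc r + Suc k) (Suc r) s) = (if even k then 1 else 0)" for k
    proof (induction k)
      case 0
      then show ?case
        using \<open>0 < r\<close> base left[of 1] SG_two_block_Suc[of "r + d" r "Suc r" s]
        by (simp add: mex_pair mex_singleton)
    next
      case (Suc k)
      \<comment> \<open>Both options have the same value, so the values alternate.\<close>
      then show ?case
        using \<open>0 < r\<close> left[of "Suc (Suc k)"]
          SG_two_block_Suc[of "r + d" r "Suc (Suc (r + k))" s]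
        by (simp add: mex_pair mex_singleton split: if_splits)
    qed
    with base show ?case by blast
  qed
  then show ?thesis by blast
qed

text \<open>The sequence 0, 1, 2, 0, 1, 0, 1, ... indexed by \<open>m - r\<close>. For odd
  \<open>d\<close> at least 3, its positive indices give the rectangles of width
  \<open>d\<close>.\<close>

definition odd_value :: "nat \<Rightarrow> nat" where
  "odd_value k = (if k \<le> 2 then k else if odd k then 0 else 1)"

lemma odd_value_0: "odd_value 0 = 0" and odd_value_1: "odd_value (Suc 0) = 1"
  by (simp_all add: odd_value_def)

text \<open>L raises the index \<open>m - r\<close> by one and T lowers it by one, so this identity
  carries the sequence unchanged from one \<open>r\<close> to the next.\<close>

lemma mex_odd_value: "mex {odd_value (Suc (Suc k)), odd_value k} = odd_value (Suc k)"
  unfolding mex_pair odd_value_def by auto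

lemma SG_rectangle_odd:
  assumes "3 \<le> d" and "odd d" and "0 < k"
  shows "SG (replicate k d) = odd_value k"
  using assms by (auto simp: SG_rectangle odd_value_def)

lemma SG_two_block_odd:
  assumes "0 < r" and "0 < s" and "3 \<le> d" and "odd d"
  shows "SG (two_block (r + d) (r + k) r s) = odd_value k"
proof -
  \<comment> \<open>The corner is the T option of \<open>m = r\<close>, whose L option has value 1;
    a nonzero corner thus forces the value 0 at \<open>m = r\<close>.\<close>
  have "SG (two_block (r + d) (r - 1) r s) \<noteq> 0 \<and>
    (\<forall>k. SG (two_block (r + d) (r + k) r s) = odd_value k)"
    using \<open>0 < r\<close>
  proof (induction r rule: nat_induct_non_zero)
    case 1
    have corner: "SG (two_block (1 + d) 0 1 s) \<noteq> 0"
      using \<open>0 < s\<close> SG_two_block_zero_one[of s "1 + d"] by simp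
    have "SG (two_block (1 + d) (1 + k) 1 s) = odd_value k" for k
    proof (induction k)
      case 0
      then show ?case
        using assms corner SG_two_block_one[of d 0 s] SG_rectangle_odd[of d 1]
        by (simp add: mex_pair odd_value_0 odd_value_1)
    next
      case (Suc k)
      then show ?case
        using assms SG_two_block_one[of d "Suc k" s] SG_rectangle_odd[of d "Suc (Suc k)"]
        by (simp add: mex_odd_value del: replicate_Suc)
    qed
    with corner show ?case by simp
  next
    case (Suc r)
    have left: "SG (two_block (r + d) (r + k) r s) = odd_value k" for k
      using Suc.IH by blast
    obtain q where q: "r = Suc q"
      using \<open>0 < r\<close> gr0_implies_Suc by blast
    \<comment> \<open>The L option is the position with \<open>m = r\<close>, of value 0. Writing
      \<open>r = Suc q\<close> exhibits the first row that T removes.\<close>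
    have corner: "SG (two_block (Suc r + d) r (Suc r) s) \<noteq> 0"
      using left[of 0] SG_two_block_Suc[of "r + d" r q s]
      by (auto simp: mex_pair odd_value_0 q)
    have "SG (two_block (Suc r + d) (Suc r + k) (Suc r) s) = odd_value k" for k
    proof (induction k)
      case 0
      then show ?case
        using \<open>0 < r\<close> corner left[of 1] SG_two_block_Suc[of "r + d" r r s]
        by (simp add: mex_pair odd_value_0 odd_value_1)
    next
      case (Suc k)
      then show ?case
        using \<open>0 < r\<close> left[of "Suc (Suc k)"] SG_two_block_Suc[of "r + d" r "Suc (r + k)" s]
        by (simp add: mex_odd_value)
    qed
    with corner show ?case by simp
  qed
  then show ?thesis by blast
qed

theorem theorem3p16:
  fixes n m r s :: nat
  assumes "0 < n" and "0 < m" and "0 < r" and "0 < s"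
    and "r < m" and "r < n"
  shows "(n = r + 1 \<or> n = r + 2 \<or> (n > r + 2 \<and> even (n - r)) \<longrightarrow>
            (even (r + m) \<longrightarrow> SG (two_block n m r s) = 0) \<and>
            (odd (r + m) \<longrightarrow> SG (two_block n m r s) = 1))
       \<and> (n > r + 2 \<and> odd (n - r) \<longrightarrow>
            (odd (m - r) \<and> m - r \<ge> 3 \<longrightarrow> SG (two_block n m r s) = 0) \<and>
            (m - r = 1 \<or> (even (m - r) \<and> m - r \<ge> 4) \<longrightarrow> SG (two_block n m r s) = 1) \<and>
            (m - r = 2 \<longrightarrow> SG (two_block n m r s) = 2))"
proof -
  define d where "d = n - r"
  \<comment> \<open>This is one less than the index of \<open>odd_value\<close>, hence the instance
    \<open>Suc k\<close> in the odd case.\<close>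
  define k where "k = m - r - 1"
  have n: "n = r + d" and m: "m = r + Suc k" and d: "0 < d"
    using assms by (auto simp: d_def k_def)
  show ?thesis
  proof (rule conjI; rule impI)
    assume "n = r + 1 \<or> n = r + 2 \<or> (n > r + 2 \<and> even (n - r))"
    then have "d = 1 \<or> even d"
      by (auto simp: d_def)
    then show "(even (r + m) \<longrightarrow> SG (two_block n m r s) = 0) \<and>
        (odd (r + m) \<longrightarrow> SG (two_block n m r s) = 1)"
      unfolding n m using SG_two_block_even_or_one[of r s d k] assms d by simp
  next
    assume "n > r + 2 \<and> odd (n - r)"
    then have "3 \<le> d" and "odd d"
      by (auto simp: d_def)
    then show "(odd (m - r) \<and> m - r \<ge> 3 \<longrightarrow> SG (two_block n m r s) = 0) \<and>
        (m - r = 1 \<or> (even (m - r) \<and> m - r \<ge> 4) \<longrightarrow> SG (two_block n m r s) = 1) \<and>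
        (m - r = 2 \<longrightarrow> SG (two_block n m r s) = 2)"
      unfolding n m using SG_two_block_odd[of r s d "Suc k"] assms by (auto simp: odd_value_def)
  qed
qed

end
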